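(* Assume $\gamma\in(1,\tfrac53]$. Then for any $p\ge 0$ the graph of $\phi$ lies above the graph of $\phi_R$; more precisely, $\phi_R(p)=\phi(p)$ for all $p\in[0,p_{\min}]$, and $\phi_R(p)<\phi(p)$ for all $p\in(p_{\min},\infty)$.
   Context: Fix $\gamma>1$ and a co-volume constant $b\ge 0$. A left state $(\rho_L,u_L,p_L)$ and a right state $(\rho_R,u_R,p_R)$ (density, velocity, pressure) are given with $\rho_L,\rho_R>0$, $1-b\rho_L>0$, $1-b\rho_R>0$, $p_L,p_R>0$ and $u_L,u_R\in\mathbb{R}$. Set $p_{\min}:=\min(p_L,p_R)$. For $Z\in\{L,R\}$ define the sound speed $a_Z:=\sqrt{\frac{\gamma p_Z}{\rho_Z(1-b\rho_Z)}}$, and $A_Z:=\frac{2(1-b\rho_Z)}{(\gamma+1)\rho_Z}$, $B_Z:=\frac{\gamma-1}{\gamma+1}p_Z$. For $p\ge 0$ define $$f(p,Z):=\begin{cases}(p-p_Z)\left(\frac{A_Z}{p+B_Z}\right)^{1/2}&\text{if }p\ge p_Z,\\ \frac{2a_Z(1-b\rho_Z)}{\gamma-1}\left(\left(\frac{p}{p_Z}\right)^{\frac{\gamma-1}{2\gamma}}-1\right)&\text{if }p<p_Z,\end{cases}$$ $$\phi(p):=f(p,L)+f(p,R)+u_R-u_L,$$ $$\phi_R(p):=\frac{2a_L(1-b\rho_L)}{\gamma-1}\left(\left(\frac{p}{p_L}\right)^{\frac{\gamma-1}{2\gamma}}-1\right)+\frac{2a_R(1-b\rho_R)}{\gamma-1}\left(\left(\frac{p}{p_R}\right)^{\frac{\gamma-1}{2\gamma}}-1\right)+u_R-u_L.$$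 *)

theory Defs
  imports Complex_Main
begin

record fluid_state =
  density :: real
  velocity :: real
  pressure :: real

definition admissible :: "real \<Rightarrow> fluid_state \<Rightarrow> bool" where
  "admissible b Z \<longleftrightarrow> density Z > 0 \<and> 1 - b * density Z > 0 \<and> pressure Z > 0"

definition sound_speed :: "real \<Rightarrow> real \<Rightarrow> fluid_state \<Rightarrow> real" where
  "sound_speed \<gamma> b Z = sqrt (\<gamma> * pressure Z / (density Z * (1 - b * density Z)))"

definition coeff_A :: "real \<Rightarrow> real \<Rightarrow> fluid_state \<Rightarrow> real" where
  "coeff_A \<gamma> b Z = 2 * (1 - b * density Z) / ((\<gamma> + 1) * density Z)"

definition coeff_B :: "real \<Rightarrow> fluid_state \<Rightarrow> real" where
  "coeff_B \<gamma> Z = (\<gamma> - 1) / (\<gamma> + 1) * pressure Z"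

(* All functions of p below are meant for p >= 0. At p = 0 the power is powr with a
   positive exponent (gamma > 1), whose library value 0 is the intended one. *)

definition shock_branch :: "real \<Rightarrow> real \<Rightarrow> real \<Rightarrow> fluid_state \<Rightarrow> real" where
  "shock_branch \<gamma> b p Z =
     (p - pressure Z) * sqrt (coeff_A \<gamma> b Z / (p + coeff_B \<gamma> Z))"

definition rarefaction_branch :: "real \<Rightarrow> real \<Rightarrow> real \<Rightarrow> fluid_state \<Rightarrow> real" where
  "rarefaction_branch \<gamma> b p Z =
     2 * sound_speed \<gamma> b Z * (1 - b * density Z) / (\<gamma> - 1)
       * ((p / pressure Z) powr ((\<gamma> - 1) / (2 * \<gamma>)) - 1)"

definition wave_f :: "real \<Rightarrow> real \<Rightarrow> real \<Rightarrow> fluid_state \<Rightarrow> real" where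
  "wave_f \<gamma> b p Z =
     (if p \<ge> pressure Z then shock_branch \<gamma> b p Z else rarefaction_branch \<gamma> b p Z)"

definition phi :: "real \<Rightarrow> real \<Rightarrow> fluid_state \<Rightarrow> fluid_state \<Rightarrow> real \<Rightarrow> real" where
  "phi \<gamma> b L R p = wave_f \<gamma> b p L + wave_f \<gamma> b p R + velocity R - velocity L"

definition phi_R :: "real \<Rightarrow> real \<Rightarrow> fluid_state \<Rightarrow> fluid_state \<Rightarrow> real \<Rightarrow> real" where
  "phi_R \<gamma> b L R p =
     rarefaction_branch \<gamma> b p L + rarefaction_branch \<gamma> b p R + velocity R - velocity L"

definition p_min :: "fluid_state \<Rightarrow> fluid_state \<Rightarrow> real" where
  "p_min L R = min (pressure L) (pressure R)"

end

theory Submission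
  imports Defs
begin

text \<open>
  The sum \<open>phi\<close> differs from \<open>phi_R\<close> only through the states whose pressure lies below \<open>p\<close>,
  so everything reduces to one state: above its pressure, the shock curve must lie strictly
  above the continuation of the rarefaction curve. In terms of the pressure ratio
  \<open>x = p / p\<^sub>Z\<close> and the exponent \<open>\<beta> = (\<gamma> - 1) / (2 * \<gamma>)\<close>, both branches carry the common factor
  \<open>sqrt (p\<^sub>Z (1 - b \<rho>\<^sub>Z) / \<rho>\<^sub>Z)\<close>; all dependence on the state and on \<open>b\<close> cancels, and what
  remains is \<open>powr_minus_one_less_shock_profile\<close>:

    \<open>x powr \<beta> - 1 < \<beta> (x - 1) / sqrt ((1 - \<beta>) x + \<beta>)\<close>  for \<open>x > 1\<close>,

  where \<open>\<gamma> \<le> 5/3\<close> says exactly that \<open>\<beta> \<le> 1/5\<close>.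

  Both sides vanish at \<open>x = 1\<close>, so it suffices to compare derivatives. With \<open>c = 1 - \<beta>\<close>, the
  logarithm of the quotient of the derivatives is
  \<open>ln ((c x + 2 - c) / 2) + c ln x - 3/2 ln (c x + 1 - c)\<close>. This is positive for \<open>x > 1\<close>
  (\<open>log_derivative_ratio_pos\<close>): it also vanishes at \<open>1\<close>, and
  its derivative has the sign of \<open>(x - 1) ((c\<^sup>2 - c/2) x - (2 - c) (1 - c))\<close>. The last factor
  at \<open>x = 1\<close> equals \<open>5c/2 - 2\<close>, so it is positive for all \<open>x > 1\<close> as soon as \<open>c \<ge> 4/5\<close>. This is
  where the bound on \<open>\<gamma>\<close> comes from: for smaller \<open>c\<close> the sign is wrong just to the right of \<open>1\<close>.
\<close>

text \<open>
  Taking logarithms turns the comparison of derivatives, which mixes the powers \<open>c\<close> and \<open>3/2\<close>,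
  into one whose own derivative is rational, so that its sign can be read off a factorisation.
\<close>

lemma log_derivative_ratio_pos:
  fixes c x :: real
  assumes c: "4/5 \<le> c" "c < 1" and x: "1 < x"
  shows "0 < ln ((c * x + 2 - c) / 2) + c * ln x - 3/2 * ln (c * x + 1 - c)"
proof -
  define k where "k = (\<lambda>x. ln ((c * x + 2 - c) / 2) + c * ln x - 3/2 * ln (c * x + 1 - c))"
  have pos: "0 < c * y + 2 - c" "0 < c * y + 1 - c" if "1 \<le> y" for y
    using mult_pos_pos[of c y] c that by linarith+
  have deriv: "(k has_real_derivative
      c * (1 / (c * y + 2 - c) + 1 / y - 3/2 / (c * y + 1 - c))) (at y)" if "1 \<le> y" for y
  proof -
    have "((\<lambda>x. ln ((c * x + 2 - c) / 2)) has_real_derivative c / (c * y + 2 - c)) (at y)"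
    proof -
      define U where "U = c * y + 2 - c"
      have "((\<lambda>x. (c * x + 2 - c) / 2) has_real_derivative c / 2) (at y)"
        by (auto intro!: derivative_eq_intros)
      moreover have "0 < (c * y + 2 - c) / 2"
        using pos[OF that] by simp
      ultimately have "((\<lambda>x. ln ((c * x + 2 - c) / 2)) has_real_derivative
          1 / (U / 2) * (c / 2)) (at y)"
        unfolding U_def by (intro DERIV_chain2[OF DERIV_ln_divide])
      then show ?thesis
        by (simp flip: U_def)
    qed
    moreover have "((\<lambda>x. c * ln x) has_real_derivative c / y) (at y)"
      using that by (auto intro!: derivative_eq_intros)
    moreover have "((\<lambda>x. 3/2 * ln (c * x + 1 - c)) has_real_derivative
        3/2 * (c / (c * y + 1 - c))) (at y)"
      using pos[OF that] by (intro DERIV_cmult) (auto intro!: derivative_eq_intros)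
    ultimately show ?thesis
      unfolding k_def by (auto intro!: DERIV_cong[OF DERIV_diff[OF DERIV_add]]
        simp: distrib_left right_diff_distrib)
  qed
  have "k 1 < k x"
  proof (rule DERIV_pos_imp_increasing_open[OF x])
    fix y assume y: "1 < y" "y < x"
    note p = pos[of y]
    have "0 < c\<^sup>2 - c/2"
      using c by (simp add: power2_eq_square algebra_simps)
    then have "c\<^sup>2 - c/2 < (c\<^sup>2 - c/2) * y"
      using y by simp
    \<comment> \<open>equivalent to \<open>4/5 \<le> c\<close>\<close>
    moreover have "(2 - c) * (1 - c) \<le> c\<^sup>2 - c/2"
      using c by (simp add: power2_eq_square algebra_simps)
    ultimately have "0 < (y - 1) * ((c\<^sup>2 - c/2) * y - (2 - c) * (1 - c))"
      using y by simp
    moreover have "1 / (c * y + 2 - c) + 1 / y - 3/2 / (c * y + 1 - c)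
        = (y - 1) * ((c\<^sup>2 - c/2) * y - (2 - c) * (1 - c))
          / ((c * y + 2 - c) * y * (c * y + 1 - c))"
      using p y by (simp add: divide_simps) (simp add: algebra_simps power2_eq_square)
    ultimately have "0 < c * (1 / (c * y + 2 - c) + 1 / y - 3/2 / (c * y + 1 - c))"
      using p y c by simp
    then show "\<exists>d. (k has_real_derivative d) (at y) \<and> 0 < d"
      using deriv[of y] y by auto
  next
    show "continuous_on {1..x} k"
      by (rule DERIV_continuous_on, rule has_field_derivative_at_within, rule deriv) auto
  qed
  then show ?thesis
    by (simp add: k_def)
qed

text \<open>
  The rarefaction curve (left) against the shock curve (right), in dimensionless form. Both
  vanish at \<open>1\<close>; below, \<open>\<beta> E / (D sqrt D)\<close> is the derivative of the right side, and
  \<open>log_derivative_ratio_pos\<close> with \<open>c = 1 - \<beta>\<close> says that it exceeds \<open>\<beta> y powr (\<beta> - 1)\<close>.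
\<close>

lemma powr_minus_one_less_shock_profile:
  fixes \<beta> x :: real
  assumes \<beta>: "0 < \<beta>" "\<beta> \<le> 1/5" and x: "1 < x"
  shows "x powr \<beta> - 1 < \<beta> * (x - 1) / sqrt ((1 - \<beta>) * x + \<beta>)"
proof -
  define D where "D = (\<lambda>y. (1 - \<beta>) * y + \<beta>)"
  define E where "E = (\<lambda>y. ((1 - \<beta>) * y + 1 + \<beta>) / 2)"
  define h where "h = (\<lambda>y. \<beta> * (y - 1) / sqrt (D y) - y powr \<beta>)"
  have pos: "0 < D y" "0 < E y" if "1 \<le> y" for y
    using mult_pos_pos[of "1 - \<beta>" y] \<beta> that unfolding D_def E_def
    by (linarith, intro divide_pos_pos) linarith+
  have deriv: "(h has_real_derivative
      \<beta> * (E y / (D y * sqrt (D y)) - y powr (\<beta> - 1))) (at y)" if y: "1 \<le> y" for y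
  proof -
    have D': "(D has_real_derivative (1 - \<beta>)) (at y)"
      unfolding D_def by (auto intro!: derivative_eq_intros)
    have "(h has_real_derivative
        (\<beta> * sqrt (D y) - \<beta> * (y - 1) * ((1 - \<beta>) / (2 * sqrt (D y)))) / (sqrt (D y))\<^sup>2
          - \<beta> * y powr (\<beta> - 1)) (at y)"
      unfolding h_def using pos[OF y] y
      by (auto intro!: derivative_eq_intros D' simp: power2_eq_square field_simps)
    moreover have "(\<beta> * sqrt (D y) - \<beta> * (y - 1) * ((1 - \<beta>) / (2 * sqrt (D y)))) / (sqrt (D y))\<^sup>2
        = \<beta> * (E y / (D y * sqrt (D y)))"
    proof -
      define s where "s = sqrt (D y)"
      have s: "0 < s" "D y = s\<^sup>2" using pos[OF y] by (simp_all add: s_def)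
      have E: "E y = s\<^sup>2 - (y - 1) * (1 - \<beta>) / 2"
        unfolding s(2)[symmetric] by (simp add: D_def E_def field_simps)
      then show ?thesis
        unfolding s_def[symmetric] s(2) using s(1)
        by (simp add: E field_simps power2_eq_square)
    qed
    ultimately show ?thesis by (simp add: right_diff_distrib)
  qed
  have "h 1 < h x"
  proof (rule DERIV_pos_imp_increasing_open[OF x])
    fix y assume y: "1 < y" "y < x"
    have "0 < ln (E y) + (1 - \<beta>) * ln y - 3/2 * ln (D y)"
    proof -
      have "E y = ((1 - \<beta>) * y + 2 - (1 - \<beta>)) / 2" "D y = (1 - \<beta>) * y + 1 - (1 - \<beta>)"
        by (simp_all add: D_def E_def)
      then show ?thesis
        using log_derivative_ratio_pos[of "1 - \<beta>" y] \<beta> y by (simp only:)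
    qed
    then have "exp ((\<beta> - 1) * ln y) < exp (ln (E y) - (ln (D y) + ln (sqrt (D y))))"
      using pos[of y] y by (simp add: ln_sqrt algebra_simps)
    also have "\<dots> = E y / (D y * sqrt (D y))"
      using pos[of y] y by (simp add: exp_diff exp_add)
    finally have "0 < \<beta> * (E y / (D y * sqrt (D y)) - y powr (\<beta> - 1))"
      using \<beta> y by (simp add: powr_def)
    then show "\<exists>d. (h has_real_derivative d) (at y) \<and> 0 < d"
      using deriv[of y] y by auto
  next
    show "continuous_on {1..x} h"
      by (rule DERIV_continuous_on, rule has_field_derivative_at_within, rule deriv) auto
  qed
  then show ?thesis
    by (simp add: h_def D_def)
qed

text \<open>
  After rescaling by the amplitude \<open>K\<close> of the rarefaction branch, this is
  \<open>powr_minus_one_less_shock_profile\<close> at the pressure ratio; the work lies in rewriting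
  \<open>\<gamma> \<plusminus> 1\<close> through \<open>\<beta>\<close>, by \<open>\<gamma> - 1 = 2 \<gamma> \<beta>\<close> and \<open>\<gamma> + 1 = 2 \<gamma> (1 - \<beta>)\<close>.
\<close>

lemma rarefaction_branch_less_shock_branch:
  fixes \<gamma> b p :: real and Z :: fluid_state
  assumes \<gamma>: "1 < \<gamma>" "\<gamma> \<le> 5/3" and adm: "admissible b Z" and p: "pressure Z < p"
  shows "rarefaction_branch \<gamma> b p Z < shock_branch \<gamma> b p Z"
proof -
  define \<beta> where "\<beta> = (\<gamma> - 1) / (2 * \<gamma>)"
  define q where "q = pressure Z"
  define m where "m = 1 - b * density Z"
  define r where "r = density Z"
  define x where "x = p / q"
  \<comment> \<open>the amplitude \<open>2 a\<^sub>Z (1 - b \<rho>\<^sub>Z) / (\<gamma> - 1)\<close> of the rarefaction branch, in a form in which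
    it can also be recognised in the shock branch\<close>
  define K where "K = sqrt (\<gamma> * q * m / r) / (\<gamma> * \<beta>)"
  have st: "0 < q" "0 < m" "0 < r"
    using adm by (simp_all add: admissible_def q_def m_def r_def)
  have x: "1 < x" "p = q * x" using p st by (simp_all add: x_def q_def)
  have \<beta>: "0 < \<beta>" "\<beta> \<le> 1/5" using \<gamma> by (simp_all add: \<beta>_def field_simps)
  have K: "0 < K" using st \<gamma> \<beta> by (simp add: K_def)
  define D where "D = (1 - \<beta>) * x + \<beta>"
  have D: "0 < D"
    using x \<beta> by (simp add: D_def add_pos_pos)
  have "sqrt (\<gamma> * q / (r * m)) * m = sqrt (\<gamma> * q * m / r)"
  proof -
    have "sqrt (\<gamma> * q / (r * m)) * m = sqrt (\<gamma> * q / (r * m) * m\<^sup>2)"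
      using st real_sqrt_mult[of "\<gamma> * q / (r * m)" "m\<^sup>2"] by simp
    also have "\<gamma> * q / (r * m) * m\<^sup>2 = \<gamma> * q * m / r"
      using st by (simp add: field_simps power2_eq_square)
    finally show ?thesis .
  qed
  moreover have "2 / (\<gamma> - 1) = 1 / (\<gamma> * \<beta>)"
    using \<gamma> by (simp add: \<beta>_def field_simps)
  ultimately have "2 / (\<gamma> - 1) * (sqrt (\<gamma> * q / (r * m)) * m) = K"
    by (simp add: K_def)
  then have rare: "rarefaction_branch \<gamma> b p Z = K * (x powr \<beta> - 1)"
    unfolding rarefaction_branch_def sound_speed_def
    by (simp add: \<beta>_def q_def m_def r_def x_def mult.assoc)
  have arg: "coeff_A \<gamma> b Z / (p + coeff_B \<gamma> Z) = (\<gamma> * q * m / r) / (\<gamma> * q)\<^sup>2 / D"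
  proof -
    have "\<gamma> * D = ((\<gamma> + 1) * x + (\<gamma> - 1)) / 2"
      using \<gamma> by (simp add: D_def \<beta>_def field_simps)
    moreover have "p + coeff_B \<gamma> Z = q * ((\<gamma> + 1) * x + (\<gamma> - 1)) / (\<gamma> + 1)"
      using \<gamma> unfolding coeff_B_def q_def[symmetric] x(2) by (simp add: field_simps)
    ultimately have B: "p + coeff_B \<gamma> Z = q * (2 * (\<gamma> * D)) / (\<gamma> + 1)"
      by simp
    have A: "coeff_A \<gamma> b Z = 2 * m / ((\<gamma> + 1) * r)"
      by (simp add: coeff_A_def m_def r_def)
    show ?thesis
      unfolding A B using \<gamma> st D by (simp add: divide_simps power2_eq_square)
  qed
  have "shock_branch \<gamma> b p Z = q * (x - 1) * (sqrt (\<gamma> * q * m / r) / (\<gamma> * q) / sqrt D)"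
  proof -
    have "0 < \<gamma> * q"
      using \<gamma> st by simp
    then have "sqrt ((\<gamma> * q * m / r) / (\<gamma> * q)\<^sup>2 / D) = sqrt (\<gamma> * q * m / r) / (\<gamma> * q) / sqrt D"
      by (simp only: real_sqrt_divide real_sqrt_abs abs_of_pos)
    moreover have "p - pressure Z = q * (x - 1)"
      unfolding x(2) q_def by (simp add: right_diff_distrib)
    ultimately show ?thesis
      by (simp only: shock_branch_def arg)
  qed
  also have "\<dots> = K * (\<beta> * (x - 1) / sqrt D)"
    using \<gamma> st \<beta> D by (simp add: K_def)
  finally show ?thesis
    unfolding rare D_def
    using mult_strict_left_mono[OF powr_minus_one_less_shock_profile[OF \<beta> x(1)] K]
    by (simp only:)
qed

text \<open>At \<open>p = p\<^sub>Z\<close> the function takes the shock branch, but both branches vanish there.\<close>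

lemma wave_f_eq_rarefaction_branch:
  assumes "p \<le> pressure Z" "0 < pressure Z"
  shows "wave_f \<gamma> b p Z = rarefaction_branch \<gamma> b p Z"
  using assms by (auto simp: wave_f_def shock_branch_def rarefaction_branch_def)

theorem theorem4p1:
  fixes \<gamma> b :: real and L R :: fluid_state
  assumes "\<gamma> \<in> {1<..5/3}"
    and "b \<ge> 0"
    and "admissible b L" and "admissible b R"
  shows "(\<forall>p\<in>{0..p_min L R}. phi_R \<gamma> b L R p = phi \<gamma> b L R p)
       \<and> (\<forall>p\<in>{p_min L R<..}. phi_R \<gamma> b L R p < phi \<gamma> b L R p)"
proof -
  have above: "rarefaction_branch \<gamma> b p Z < wave_f \<gamma> b p Z"
    if "admissible b Z" "pressure Z < p" for p Z
    using rarefaction_branch_less_shock_branch[of \<gamma> b Z p] assms(1) that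
    by (simp add: wave_f_def)
  have below: "wave_f \<gamma> b p Z = rarefaction_branch \<gamma> b p Z"
    if "admissible b Z" "p \<le> pressure Z" for p Z
    using wave_f_eq_rarefaction_branch that by (simp add: admissible_def)
  have weak: "rarefaction_branch \<gamma> b p Z \<le> wave_f \<gamma> b p Z" if "admissible b Z" for p Z
    using above[OF that, of p] below[OF that, of p] by linarith
  have "phi_R \<gamma> b L R p < phi \<gamma> b L R p" if "p_min L R < p" for p
  proof -
    from that consider "pressure L < p" | "pressure R < p"
      by (auto simp: p_min_def min_less_iff_disj)
    then show ?thesis
    proof cases
      case 1
      then show ?thesis
        using above[OF assms(3), of p] weak[OF assms(4), of p] by (simp add: phi_def phi_R_def)
    next
      case 2
      then show ?thesis
        using above[OF assms(4), of p] weak[OF assms(3), of p] by (simp add: phi_def phi_R_def)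
    qed
  qed
  then show ?thesis
    using below[OF assms(3)] below[OF assms(4)] by (auto simp: phi_def phi_R_def p_min_def)
qed

end
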